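(* Let $u$ be a smooth solution of the KP-II equation $(-4u_t+u_{xxx}+6uu_x)_x+3u_{yy}=0$ of the form $u(t,x,y)=2\partial_x^2 F(\Theta(t,x,y))$, with smooth phase $\Theta$ and smooth profile $F$ such that $F(1)=0$, $F'(1)=1$, $F''(1)=-1$ and $F'''(1)=2$. Then $u$ is a KdV soliton and $F=\log$ if and only if $H(\Theta)=Ai(\Theta)=W_y(\Theta)=0$ for all $(t,x,y)\in\mathbb R^3$.
   Context: Setting: $(t,x,y)\in\mathbb R^3$ and $u$ is real valued. For some $s_0>0$ the profile $F:[s_0,\infty)\to\mathbb R$ and the phase $\Theta=\Theta(t,x,y)\in[s_0,\infty)$ are smooth; the convention is $s_0=1$ (without loss of generality). For $u=2\partial_x^2F(\Theta)$ the KP-II equation is used in its twice-integrated form (obtained assuming convergence to zero at infinity): with $f=F(\Theta)$, $-4\partial_t\partial_x f+\partial_x^4 f+6(\partial_x^2 f)^2+3\partial_y^2 f=0$. Operators: $H(\Theta):=\Theta_y-\Theta_{xx}$, $Ai(\Theta):=\Theta_t-\Theta_{xxx}$, and, for $\Theta>0$, $W_y(\Theta):=\Theta_{yy}-\Theta_y^2/\Theta$. Line solitons: phases $\Theta=a_1e^{\theta_1}+a_2e^{\theta_2}$ with $a_1,a_2>0$, $\theta_j=k_jx+k_j^2y+k_j^3t$, $k_1,k_2\in\mathbb R$, together with $F=\log$. The KdV soliton (vertical line-soliton) is the case $k_1=-k_2=k$, i.e. $F=\log$ and $\Theta=a_1e^{kx+k^2y+k^3t}+a_2e^{-kx+k^2y-k^3t}$;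 for $a_1=a_2$ this gives $u=Q_k(t,x):=2k^2\operatorname{sech}^2(kx+k^3t)$. "$u$ is a KdV soliton and $F=\log$" means that $F=\log$ and $\Theta$ is of this form.
   Formalization: Added: u is not identically zero (otherwise false: Θ=1, F(s)=log s+(s-1)^4 gives u=0 and H=Ai=W_y=0 but F is not log). F may live on (0,∞) as well as on [s0,∞) with 0<s0≤1; KP-II is also assumed in its twice-integrated form. *)

theory Defs
  imports "HOL-Analysis.Analysis"
begin

text \<open>Functions of $(t,x,y)$ are curried, with the arguments in this order.\<close>

type_synonym field3 = "real \<Rightarrow> real \<Rightarrow> real \<Rightarrow> real"

definition pd_t :: "field3 \<Rightarrow> field3" where
  "pd_t f = (\<lambda>t x y. deriv (\<lambda>\<tau>. f \<tau> x y) t)"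

definition pd_x :: "field3 \<Rightarrow> field3" where
  "pd_x f = (\<lambda>t x y. deriv (\<lambda>\<xi>. f t \<xi> y) x)"

definition pd_y :: "field3 \<Rightarrow> field3" where
  "pd_y f = (\<lambda>t x y. deriv (\<lambda>\<eta>. f t x \<eta>) y)"

inductive iterated_partial :: "field3 \<Rightarrow> field3 \<Rightarrow> bool" for f :: field3 where
  "iterated_partial f f"
| "iterated_partial f g \<Longrightarrow> iterated_partial f (pd_t g)"
| "iterated_partial f g \<Longrightarrow> iterated_partial f (pd_x g)"
| "iterated_partial f g \<Longrightarrow> iterated_partial f (pd_y g)"

text \<open>Smooth on the whole space: every iterated partial derivative is (Frechet) differentiable,
  hence continuous.\<close>

definition smooth3 :: "field3 \<Rightarrow> bool" where
  "smooth3 f \<longleftrightarrow>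
     (\<forall>g. iterated_partial f g \<longrightarrow> (\<lambda>(t, x, y). g t x y) differentiable_on UNIV)"

text \<open>A profile lives on a ray: either $[s_0,\infty)$ with $0 < s_0 \le 1$, so that the
  normalisation at $1$ makes sense, or the limiting case $(0,\infty)$. The latter is indispensable:
  the phase of a KdV soliton with $k \neq 0$ takes all values in $(0,\infty)$.\<close>

definition profile_domain :: "real set \<Rightarrow> bool" where
  "profile_domain S \<longleftrightarrow> (\<exists>s\<^sub>0. 0 < s\<^sub>0 \<and> s\<^sub>0 \<le> 1 \<and> S = {s\<^sub>0..}) \<or> S = {0<..}"

text \<open>The derivatives are taken within the domain, so they are one-sided at a boundary point.\<close>

definition profile_deriv :: "real set \<Rightarrow> nat \<Rightarrow> (real \<Rightarrow> real) \<Rightarrow> real \<Rightarrow> real" where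
  "profile_deriv S n F = ((\<lambda>G s. vector_derivative G (at s within S)) ^^ n) F"

definition smooth_profile :: "real set \<Rightarrow> (real \<Rightarrow> real) \<Rightarrow> bool" where
  "smooth_profile S F \<longleftrightarrow> (\<forall>n. profile_deriv S n F differentiable_on S)"

definition KP_II :: "field3 \<Rightarrow> bool" where
  "KP_II u \<longleftrightarrow> (\<forall>t x y.
     pd_x (\<lambda>t x y. - 4 * pd_t u t x y + pd_x (pd_x (pd_x u)) t x y + 6 * u t x y * pd_x u t x y) t x y
       + 3 * pd_y (pd_y u) t x y = 0)"

text \<open>For $u = 2 \partial_x^2 f$ the KP-II equation reads $2 \partial_x^2 E = 0$, where $E$ is the
  left-hand side below; convergence to zero at infinity turns this into $E = 0$.\<close>

definition KP_II_integrated :: "field3 \<Rightarrow> bool" where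
  "KP_II_integrated f \<longleftrightarrow> (\<forall>t x y.
     - 4 * pd_t (pd_x f) t x y + pd_x (pd_x (pd_x (pd_x f))) t x y
       + 6 * (pd_x (pd_x f) t x y)\<^sup>2 + 3 * pd_y (pd_y f) t x y = 0)"

definition heat_op :: "field3 \<Rightarrow> field3" where
  "heat_op \<Theta> = (\<lambda>t x y. pd_y \<Theta> t x y - pd_x (pd_x \<Theta>) t x y)"

definition airy_op :: "field3 \<Rightarrow> field3" where
  "airy_op \<Theta> = (\<lambda>t x y. pd_t \<Theta> t x y - pd_x (pd_x (pd_x \<Theta>)) t x y)"

definition wave_y_op :: "field3 \<Rightarrow> field3" where
  "wave_y_op \<Theta> = (\<lambda>t x y. pd_y (pd_y \<Theta>) t x y - (pd_y \<Theta> t x y)\<^sup>2 / \<Theta> t x y)"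

definition line_phase :: "real \<Rightarrow> real \<Rightarrow> real \<Rightarrow> real \<Rightarrow> field3" where
  "line_phase a\<^sub>1 a\<^sub>2 k\<^sub>1 k\<^sub>2 = (\<lambda>t x y.
     a\<^sub>1 * exp (k\<^sub>1 * x + k\<^sub>1 ^ 2 * y + k\<^sub>1 ^ 3 * t) + a\<^sub>2 * exp (k\<^sub>2 * x + k\<^sub>2 ^ 2 * y + k\<^sub>2 ^ 3 * t))"

definition KdV_soliton_phase :: "field3 \<Rightarrow> bool" where
  "KdV_soliton_phase \<Theta> \<longleftrightarrow> (\<exists>a\<^sub>1 a\<^sub>2 k. a\<^sub>1 > 0 \<and> a\<^sub>2 > 0 \<and> \<Theta> = line_phase a\<^sub>1 a\<^sub>2 k (- k))"

end

theory Submission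
  imports Defs
begin

text \<open>
  For a KdV soliton the three equations are a direct computation, since \<open>\<partial>\<^sub>t\<close>, \<open>\<partial>\<^sub>x\<close> and
  \<open>\<partial>\<^sub>y\<close> act diagonally on the two exponentials of the phase. The content is the converse.

  \<^bold>\<open>The phase.\<close> \<open>\<Theta>\<^sub>y\<^sub>y = \<Theta>\<^sub>y\<^sup>2 / \<Theta>\<close> says that \<open>ln \<Theta>\<close> is affine in \<open>y\<close>, so
  \<open>\<Theta>(t,x,y) = \<Theta>(t,x,0) exp(B(t,x) y)\<close>. By the heat equation the three functions
  \<open>x \<mapsto> \<Theta>(t,x,j)\<close> with \<open>j = 0, 1, 2\<close> solve the same equation \<open>h'' = B h\<close>, while they are in
  geometric progression. This forces their logarithmic derivatives to agree
  (\<open>geometric_solutions_same_log_derivative\<close>), so \<open>exp B = \<Theta>(t,x,1) / \<Theta>(t,x,0)\<close> does not depend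
  on \<open>x\<close>; as then \<open>\<Theta>\<^sub>t = \<Theta>\<^sub>x\<^sub>x\<^sub>x = B \<Theta>\<^sub>x\<close>, it does not depend on \<open>t\<close> either. With a constant
  \<open>B = b\<close>, positivity excludes oscillation (\<open>b < 0\<close>) and affine growth (\<open>b = 0\<close>), and leaves
  \<open>\<Theta> = a\<^sub>1 exp(k x + k\<^sup>2 y + k\<^sup>3 t) + a\<^sub>2 exp(- k x + k\<^sup>2 y - k\<^sup>3 t)\<close> with \<open>a\<^sub>1, a\<^sub>2 \<ge> 0\<close>
  (\<open>positive_phase_is_exponential_sum\<close>).

  \<^bold>\<open>The profile.\<close> Let \<open>D\<close> be the difference of the two exponential terms. For such a phase
  the linear terms of the integrated equation cancel and it becomes
  \<open>F'''' D\<^sup>4 + 6 F''' \<Theta> D\<^sup>2 + 6 F'' \<Theta>\<^sup>2 + 6 (F'' D\<^sup>2 + F' \<Theta>)\<^sup>2 = 0\<close>, provided \<open>k \<noteq> 0\<close>, which holds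
  because \<open>u\<close> is not identically zero (\<open>pd_profile_of_line_phase\<close>). If both exponentials
  are present, every value \<open>s > 0\<close> of \<open>\<Theta>\<close> is taken at a point with \<open>D = 0\<close>. There the equation is
  \<open>F'' + F'\<^sup>2 = 0\<close>, that is \<open>(exp F)'' = 0\<close>, and the data at \<open>1\<close> give \<open>F = ln\<close>. If only one is
  present, \<open>D\<^sup>2 = \<Theta>\<^sup>2\<close>, and \<open>w(z) = (d/dz)\<^sup>2 F(exp z)\<close> satisfies \<open>w'' = w - 6 w\<^sup>2\<close> with
  \<open>w(0) = w'(0) = 0\<close>, by the data at \<open>1\<close>. So \<open>w = 0\<close>, and \<open>u = 2 k\<^sup>2 w(ln \<Theta>)\<close> vanishes, which
  is excluded.
\<close>

section \<open>Partial derivatives of smooth functions and of line phases\<close>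

lemma iterated_partial_trans:
  assumes "iterated_partial g h" "iterated_partial f g"
  shows "iterated_partial f h"
  using assms by (induction rule: iterated_partial.induct) (auto intro: iterated_partial.intros)

lemma smooth3_pd:
  assumes "smooth3 f"
  shows "smooth3 (pd_t f)" "smooth3 (pd_x f)" "smooth3 (pd_y f)"
  using assms unfolding smooth3_def
  by (meson iterated_partial.intros iterated_partial_trans)+

text \<open>A partial derivative is the derivative of the function along an affine line, so its existence
  follows from total differentiability by the chain rule.\<close>

lemma smooth3_has_pd:
  assumes "smooth3 f"
  shows "((\<lambda>\<tau>. f \<tau> x y) has_real_derivative pd_t f t x y) (at t)"
    and "((\<lambda>\<xi>. f t \<xi> y) has_real_derivative pd_x f t x y) (at x)"
    and "((\<lambda>\<eta>. f t x \<eta>) has_real_derivative pd_y f t x y) (at y)"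
proof -
  have diff: "(\<lambda>(t, x, y). f t x y) differentiable at p" for p
    using assms iterated_partial.intros(1)[of f]
    unfolding smooth3_def differentiable_on_def by blast
  have lines: "(\<lambda>\<tau>. (\<tau>, x, y)) differentiable at t" "(\<lambda>\<xi>. (t, \<xi>, y)) differentiable at x"
    "(\<lambda>\<eta>. (t, x, \<eta>)) differentiable at y"
    unfolding differentiable_def by (auto intro!: exI derivative_eq_intros)
  have "(\<lambda>\<tau>. f \<tau> x y) field_differentiable at t"
    using differentiable_compose[OF diff lines(1)]
    by (simp add: real_differentiable_def field_differentiable_def)
  then show "((\<lambda>\<tau>. f \<tau> x y) has_real_derivative pd_t f t x y) (at t)"
    unfolding pd_t_def by (simp add: field_differentiable_derivI)
  have "(\<lambda>\<xi>. f t \<xi> y) field_differentiable at x"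
    using differentiable_compose[OF diff lines(2)]
    by (simp add: real_differentiable_def field_differentiable_def)
  then show "((\<lambda>\<xi>. f t \<xi> y) has_real_derivative pd_x f t x y) (at x)"
    unfolding pd_x_def by (simp add: field_differentiable_derivI)
  have "(\<lambda>\<eta>. f t x \<eta>) field_differentiable at y"
    using differentiable_compose[OF diff lines(3)]
    by (simp add: real_differentiable_def field_differentiable_def)
  then show "((\<lambda>\<eta>. f t x \<eta>) has_real_derivative pd_y f t x y) (at y)"
    unfolding pd_y_def by (simp add: field_differentiable_derivI)
qed

lemma pd_eqI:
  shows "(\<And>t x y. ((\<lambda>\<tau>. f \<tau> x y) has_real_derivative g t x y) (at t)) \<Longrightarrow> pd_t f = g"
    and "(\<And>t x y. ((\<lambda>\<xi>. f t \<xi> y) has_real_derivative g t x y) (at x)) \<Longrightarrow> pd_x f = g"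
    and "(\<And>t x y. ((\<lambda>\<eta>. f t x \<eta>) has_real_derivative g t x y) (at y)) \<Longrightarrow> pd_y f = g"
  unfolding pd_t_def pd_x_def pd_y_def by (auto intro!: ext DERIV_imp_deriv)

text \<open>Allowing amplitudes of any sign makes the family of line phases closed under differentiation.\<close>

lemma line_phase_has_derivative:
  shows "((\<lambda>\<tau>. line_phase a b k l \<tau> x y) has_real_derivative
      line_phase (k ^ 3 * a) (l ^ 3 * b) k l t x y) (at t)"
    and "((\<lambda>\<xi>. line_phase a b k l t \<xi> y) has_real_derivative
      line_phase (k * a) (l * b) k l t x y) (at x)"
    and "((\<lambda>\<eta>. line_phase a b k l t x \<eta>) has_real_derivative
      line_phase (k ^ 2 * a) (l ^ 2 * b) k l t x y) (at y)"
  unfolding line_phase_def by (auto intro!: derivative_eq_intros)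

lemma pd_line_phase:
  shows "pd_t (line_phase a b k l) = line_phase (k ^ 3 * a) (l ^ 3 * b) k l"
    and "pd_x (line_phase a b k l) = line_phase (k * a) (l * b) k l"
    and "pd_y (line_phase a b k l) = line_phase (k ^ 2 * a) (l ^ 2 * b) k l"
  by (rule pd_eqI, rule line_phase_has_derivative)+

lemma line_phase_cmult: "line_phase (c * a) (c * b) k l t x y = c * line_phase a b k l t x y"
  by (simp add: line_phase_def algebra_simps)

lemma KdV_soliton_phase_equations:
  assumes "KdV_soliton_phase \<Theta>"
  shows "heat_op \<Theta> t x y = 0" "airy_op \<Theta> t x y = 0" "wave_y_op \<Theta> t x y = 0"
proof -
  obtain a b k where "a > 0" "b > 0" and \<Theta>: "\<Theta> = line_phase a b k (- k)"
    using assms unfolding KdV_soliton_phase_def by blast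
  then have "line_phase a b k (- k) t x y > 0"
    unfolding line_phase_def by (intro add_pos_pos mult_pos_pos) auto
  then show "heat_op \<Theta> t x y = 0" "airy_op \<Theta> t x y = 0" "wave_y_op \<Theta> t x y = 0"
    by (simp_all add: \<Theta> heat_op_def airy_op_def wave_y_op_def pd_line_phase
        line_phase_cmult power2_eq_square power3_eq_cube mult.assoc)
qed

section \<open>Linear ordinary differential equations\<close>

lemma exponential_ODE:
  fixes f :: "real \<Rightarrow> real"
  assumes "\<And>x. (f has_real_derivative c * f x) (at x)"
  shows "f x = f 0 * exp (c * x)"
proof -
  have "((\<lambda>x. f x * exp (- c * x)) has_real_derivative 0) (at x)" for x
    by (rule derivative_eq_intros assms refl | simp)+
  then have "f x * exp (- c * x) = f 0 * exp (- c * 0)"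
    by (intro DERIV_isconst_all) blast
  then show ?thesis
    by (simp add: exp_minus field_simps)
qed

text \<open>For \<open>b = - w\<^sup>2 < 0\<close> a solution is a sinusoid of frequency \<open>w\<close>, and changes sign after half a
  period. The Wronskian with \<open>sin (w x)\<close> shows \<open>h (pi / w) = - h 0\<close> without solving the
  equation.\<close>

lemma positive_solution_rate_nonneg:
  fixes h g :: "real \<Rightarrow> real"
  assumes h: "\<And>x. (h has_real_derivative g x) (at x)"
    and g: "\<And>x. (g has_real_derivative b * h x) (at x)"
    and pos: "\<And>x. h x > 0"
  shows "b \<ge> 0"
proof (rule ccontr)
  define w where "w = sqrt (- b)"
  assume "\<not> b \<ge> 0"
  then have "w > 0" and b: "b = - (w * w)"
    by (auto simp: w_def)
  have "((\<lambda>x. g x * sin (w * x) - w * h x * cos (w * x)) has_real_derivative 0) (at x)" for x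
    by (rule derivative_eq_intros h g refl | simp add: b algebra_simps)+
  then have "g (pi / w) * sin (w * (pi / w)) - w * h (pi / w) * cos (w * (pi / w))
      = g 0 * sin (w * 0) - w * h 0 * cos (w * 0)"
    by (intro DERIV_isconst_all[where f = "\<lambda>x. g x * sin (w * x) - w * h x * cos (w * x)"]) blast
  then have "w * (h (pi / w) + h 0) = 0"
    using \<open>w > 0\<close> by (simp add: algebra_simps)
  then show False
    using \<open>w > 0\<close> pos[of "pi / w"] pos[of 0] by simp
qed

lemma positive_affine_slope_zero:
  fixes h g :: "real \<Rightarrow> real"
  assumes h: "\<And>x. (h has_real_derivative g x) (at x)"
    and g: "\<And>x. (g has_real_derivative 0) (at x)"
    and pos: "\<And>x. h x > 0"
  shows "g x = 0"
proof (rule ccontr)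
  assume nz: "g x \<noteq> 0"
  have g_const: "g z = g x" for z
    using g by (intro DERIV_isconst_all) blast
  have "((\<lambda>z. h z - g x * z) has_real_derivative 0) (at z)" for z
    by (rule derivative_eq_intros h refl | simp add: g_const[of z])+
  then have "h z - g x * z = h 0 - g x * 0" for z
    by (intro DERIV_isconst_all[where f = "\<lambda>z. h z - g x * z"]) blast
  from this[of "- h 0 / g x"] have "h (- h 0 / g x) = 0"
    using nz by simp
  then show False
    using pos[of "- h 0 / g x"] by simp
qed

text \<open>The operator \<open>(d/dx)\<^sup>2 - k\<^sup>2\<close> factors, so \<open>k h + h'\<close> and \<open>k h - h'\<close> solve first-order equations with
  rates \<open>k\<close> and \<open>- k\<close>.\<close>

lemma hyperbolic_ODE:
  fixes h g :: "real \<Rightarrow> real"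
  assumes h: "\<And>x. (h has_real_derivative g x) (at x)"
    and g: "\<And>x. (g has_real_derivative k\<^sup>2 * h x) (at x)"
    and "k \<noteq> 0"
  shows "h x = (k * h 0 + g 0) / (2 * k) * exp (k * x) + (k * h 0 - g 0) / (2 * k) * exp (- k * x)"
    and "g x = k * ((k * h 0 + g 0) / (2 * k) * exp (k * x) - (k * h 0 - g 0) / (2 * k) * exp (- k * x))"
proof -
  have plus: "k * h x + g x = (k * h 0 + g 0) * exp (k * x)"
    by (rule exponential_ODE)
      (rule derivative_eq_intros h g refl | simp add: power2_eq_square algebra_simps)+
  have minus: "k * h x - g x = (k * h 0 - g 0) * exp (- k * x)"
    by (rule exponential_ODE)
      (rule derivative_eq_intros h g refl | simp add: power2_eq_square algebra_simps)+
  have h_half: "h x = ((k * h x + g x) + (k * h x - g x)) / (2 * k)"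
    and g_half: "g x = k * (((k * h x + g x) - (k * h x - g x)) / (2 * k))"
    using \<open>k \<noteq> 0\<close> by simp_all
  have collect: "(p * r + q * s) / m = p / m * r + q / m * s" "(p * r - q * s) / m = p / m * r - q / m * s"
    for p q r s m :: real
    by (simp_all add: add_divide_distrib diff_divide_distrib)
  show "h x = (k * h 0 + g 0) / (2 * k) * exp (k * x) + (k * h 0 - g 0) / (2 * k) * exp (- k * x)"
    using h_half unfolding plus minus collect .
  show "g x = k * ((k * h 0 + g 0) / (2 * k) * exp (k * x) - (k * h 0 - g 0) / (2 * k) * exp (- k * x))"
    using g_half unfolding plus minus collect .
qed

lemma exponentials_independent:
  fixes a b k :: real
  assumes "\<And>x. a * exp (k * x) + b * exp (- k * x) = 0" and "k \<noteq> 0"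
  shows "a = 0" "b = 0"
  \<comment> \<open>At \<open>x = ln 2 / k\<close> the exponentials are \<open>2\<close> and \<open>1 / 2\<close>.\<close>
  using assms(1)[of 0] assms(1)[of "ln 2 / k"] \<open>k \<noteq> 0\<close> by (auto simp: exp_minus)

lemma exponentials_positive_imp_coeffs_nonneg:
  fixes a b k :: real
  assumes pos: "\<And>x. a * exp (k * x) + b * exp (- k * x) > 0" and "k \<noteq> 0"
  shows "a \<ge> 0" "b \<ge> 0"
proof -
  have False if "a * b < 0"
  proof -
    \<comment> \<open>The point where terms of opposite sign would cancel.\<close>
    define x where "x = ln (- b / a) / (2 * k)"
    have "- b / a > 0"
      using that by (auto simp: mult_less_0_iff divide_neg_pos divide_pos_neg)
    then have "exp (k * x) * exp (k * x) = - b / a"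
      using \<open>k \<noteq> 0\<close> by (simp add: x_def flip: exp_add)
    then have "a * exp (k * x) + b * exp (- k * x) = 0"
      using that by (auto simp: exp_minus field_simps)
    then show False
      using pos[of x] by simp
  qed
  then show "a \<ge> 0" "b \<ge> 0"
    using pos[of 0] by (force simp: mult_less_0_iff)+
qed

text \<open>Gronwall's argument: where \<open>\<bar>1 + q\<bar> \<le> C\<close>, the derivative of \<open>w\<^sup>2 + w'\<^sup>2\<close> is at most
  \<open>C (w\<^sup>2 + w'\<^sup>2)\<close>, so a vanishing initial value forces it to stay zero to the right of \<open>0\<close>;
  reflection \<open>z \<mapsto> - z\<close> gives the left side. Since \<open>q\<close> may depend on \<open>w\<close> itself, this also covers
  nonlinear equations \<open>w'' = q(w) w\<close>.\<close>

lemma second_order_linear_uniqueness: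
  fixes w v q :: "real \<Rightarrow> real"
  assumes w: "\<And>z. (w has_real_derivative v z) (at z)"
    and v: "\<And>z. (v has_real_derivative q z * w z) (at z)"
    and q: "continuous_on UNIV q"
    and init: "w 0 = 0" "v 0 = 0"
  shows "w z = 0"
proof -
  have forward: "w z = 0"
    if w: "\<And>z. (w has_real_derivative v z) (at z)"
      and v: "\<And>z. (v has_real_derivative q z * w z) (at z)"
      and q: "continuous_on UNIV q"
      and init: "w 0 = 0" "v 0 = 0" and "z \<ge> 0"
    for w v q :: "real \<Rightarrow> real" and z
  proof -
    have "compact ((\<lambda>x. 1 + q x) ` {0..z})"
      by (intro compact_continuous_image continuous_intros continuous_on_subset[OF q]) auto
    then obtain C where C: "\<And>x. x \<in> {0..z} \<Longrightarrow> \<bar>1 + q x\<bar> \<le> C"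
      unfolding bounded_iff by (metis bounded_iff compact_imp_bounded image_eqI real_norm_def)
    define \<phi> where "\<phi> = (\<lambda>x. ((w x)\<^sup>2 + (v x)\<^sup>2) * exp (- C * x))"
    have d\<phi>: "(\<phi> has_real_derivative
        (2 * (1 + q x) * w x * v x - C * ((w x)\<^sup>2 + (v x)\<^sup>2)) * exp (- C * x)) (at x)" for x
      unfolding \<phi>_def
      by (rule derivative_eq_intros w v refl | simp add: algebra_simps)+
    have "(2 * (1 + q x) * w x * v x - C * ((w x)\<^sup>2 + (v x)\<^sup>2)) * exp (- C * x) \<le> 0"
      if "x \<in> {0..z}" for x
    proof -
      have young: "2 * \<bar>w x * v x\<bar> \<le> (w x)\<^sup>2 + (v x)\<^sup>2"
        using sum_squares_bound[of "\<bar>w x\<bar>" "\<bar>v x\<bar>"] by (simp add: abs_mult)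
      have "2 * (1 + q x) * w x * v x = (1 + q x) * (2 * (w x * v x))"
        by simp
      also have "\<dots> \<le> \<bar>1 + q x\<bar> * \<bar>2 * (w x * v x)\<bar>"
        by (metis abs_ge_self abs_mult)
      also have "\<dots> = \<bar>1 + q x\<bar> * (2 * \<bar>w x * v x\<bar>)"
        by (simp only: abs_mult abs_numeral)
      also have "\<dots> \<le> C * ((w x)\<^sup>2 + (v x)\<^sup>2)"
        using C[OF that] young by (intro mult_mono) auto
      finally show ?thesis
        by (simp add: mult_nonpos_nonneg)
    qed
    then have "\<phi> z \<le> \<phi> 0"
      using d\<phi> \<open>z \<ge> 0\<close> by (intro DERIV_nonpos_imp_nonincreasing[of 0 z \<phi>]) (auto intro!: exI)
    then have "(w z)\<^sup>2 + (v z)\<^sup>2 \<le> 0"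
      by (simp add: \<phi>_def init mult_le_0_iff)
    then show "w z = 0"
      by (simp add: sum_power2_le_zero_iff)
  qed
  show ?thesis
  proof (cases "z \<ge> 0")
    case True
    then show ?thesis using forward[OF w v q init] by blast
  next
    case False
    have "w (- (- z)) = 0"
    proof (rule forward[where w = "\<lambda>z. w (- z)" and v = "\<lambda>z. - v (- z)" and q = "\<lambda>z. q (- z)"])
      show "((\<lambda>z. w (- z)) has_real_derivative - v (- x)) (at x)" for x
        using iffD1[OF DERIV_mirror w[of "- x"]] by simp
      show "((\<lambda>z. - v (- z)) has_real_derivative q (- x) * w (- x)) (at x)" for x
        using DERIV_minus[OF iffD1[OF DERIV_mirror v[of "- x"]]] by simp
      show "continuous_on UNIV (\<lambda>z. q (- z))"
        by (intro continuous_on_compose2[OF q] continuous_intros) auto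
    qed (use False init in auto)
    then show ?thesis by simp
  qed
qed

section \<open>The three phase equations\<close>

lemma log_derivative_constant:
  fixes h g :: "real \<Rightarrow> real"
  assumes h: "\<And>y. (h has_real_derivative g y) (at y)"
    and g: "\<And>y. (g has_real_derivative (g y)\<^sup>2 / h y) (at y)"
    and pos: "\<And>y. h y > 0"
  shows "g y = g 0 / h 0 * h y" and "h y = h 0 * exp (g 0 / h 0 * y)"
proof -
  have "((\<lambda>y. g y / h y) has_real_derivative 0) (at y)" for y
    using pos[of y] by (auto intro!: derivative_eq_intros h g simp: field_simps power2_eq_square)
  then have "g y / h y = g 0 / h 0" for y
    by (intro DERIV_isconst_all[where f = "\<lambda>y. g y / h y"]) blast
  then show g_eq: "g y = g 0 / h 0 * h y" for y
    using pos by (metis less_irrefl nonzero_divide_eq_eq)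
  show "h y = h 0 * exp (g 0 / h 0 * y)"
    by (rule exponential_ODE) (use h g_eq in metis)
qed

text \<open>Write \<open>r\<^sub>j = g\<^sub>j / h\<^sub>j\<close> for the logarithmic derivatives. Differentiating \<open>h\<^sub>0 h\<^sub>2 = h\<^sub>1\<^sup>2\<close> once gives
  \<open>r\<^sub>0 + r\<^sub>2 = 2 r\<^sub>1\<close>. Differentiating it twice gives \<open>r\<^sub>0 r\<^sub>2 = r\<^sub>1\<^sup>2\<close>, because all terms with \<open>b\<close> cancel.
  Hence \<open>(r\<^sub>0 - r\<^sub>2)\<^sup>2 = (r\<^sub>0 + r\<^sub>2)\<^sup>2 - 4 r\<^sub>0 r\<^sub>2 = 0\<close> and \<open>r\<^sub>0 = r\<^sub>1 = r\<^sub>2\<close>. The proof uses these identities with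
  denominators cleared.\<close>

lemma geometric_solutions_same_log_derivative:
  fixes h\<^sub>0 h\<^sub>1 h\<^sub>2 :: "real \<Rightarrow> real"
  assumes h: "\<And>x. (h\<^sub>0 has_real_derivative g\<^sub>0 x) (at x)" "\<And>x. (h\<^sub>1 has_real_derivative g\<^sub>1 x) (at x)"
      "\<And>x. (h\<^sub>2 has_real_derivative g\<^sub>2 x) (at x)"
    and g: "\<And>x. (g\<^sub>0 has_real_derivative b x * h\<^sub>0 x) (at x)"
      "\<And>x. (g\<^sub>1 has_real_derivative b x * h\<^sub>1 x) (at x)"
      "\<And>x. (g\<^sub>2 has_real_derivative b x * h\<^sub>2 x) (at x)"
    and nonzero: "\<And>x. h\<^sub>1 x \<noteq> 0"
    and geometric: "\<And>x. h\<^sub>0 x * h\<^sub>2 x = (h\<^sub>1 x)\<^sup>2"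
  shows "g\<^sub>1 x * h\<^sub>0 x = h\<^sub>1 x * g\<^sub>0 x"
proof -
  have "((\<lambda>x. h\<^sub>0 x * h\<^sub>2 x) has_real_derivative g\<^sub>0 x * h\<^sub>2 x + h\<^sub>0 x * g\<^sub>2 x) (at x)"
    and "((\<lambda>x. (h\<^sub>1 x)\<^sup>2) has_real_derivative 2 * h\<^sub>1 x * g\<^sub>1 x) (at x)" for x
    by (auto intro!: derivative_eq_intros h)
  then have first: "g\<^sub>0 x * h\<^sub>2 x + h\<^sub>0 x * g\<^sub>2 x = 2 * h\<^sub>1 x * g\<^sub>1 x" for x
    unfolding geometric using DERIV_unique by blast
  have "((\<lambda>x. g\<^sub>0 x * h\<^sub>2 x + h\<^sub>0 x * g\<^sub>2 x) has_real_derivative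
      2 * b x * (h\<^sub>0 x * h\<^sub>2 x) + 2 * g\<^sub>0 x * g\<^sub>2 x) (at x)"
    and "((\<lambda>x. 2 * h\<^sub>1 x * g\<^sub>1 x) has_real_derivative 2 * (g\<^sub>1 x)\<^sup>2 + 2 * b x * (h\<^sub>1 x)\<^sup>2) (at x)" for x
    by (auto intro!: derivative_eq_intros h g simp: power2_eq_square algebra_simps)
  then have "2 * b x * (h\<^sub>0 x * h\<^sub>2 x) + 2 * g\<^sub>0 x * g\<^sub>2 x = 2 * (g\<^sub>1 x)\<^sup>2 + 2 * b x * (h\<^sub>1 x)\<^sup>2"
    unfolding first using DERIV_unique by blast
  then have second: "g\<^sub>0 x * g\<^sub>2 x = (g\<^sub>1 x)\<^sup>2"
    by (simp add: geometric)
  have "(g\<^sub>0 x * h\<^sub>2 x - h\<^sub>0 x * g\<^sub>2 x)\<^sup>2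
      = (g\<^sub>0 x * h\<^sub>2 x + h\<^sub>0 x * g\<^sub>2 x)\<^sup>2 - 4 * (g\<^sub>0 x * g\<^sub>2 x) * (h\<^sub>0 x * h\<^sub>2 x)"
    by (simp add: power2_eq_square algebra_simps)
  also have "\<dots> = 0"
    unfolding first second geometric by (simp add: power2_eq_square)
  finally have "g\<^sub>0 x * h\<^sub>2 x = h\<^sub>0 x * g\<^sub>2 x"
    by simp
  then have "g\<^sub>0 x * h\<^sub>2 x = h\<^sub>1 x * g\<^sub>1 x"
    using first[of x] by linarith
  then have "g\<^sub>0 x * (h\<^sub>0 x * h\<^sub>2 x) = h\<^sub>0 x * (h\<^sub>1 x * g\<^sub>1 x)"
    by simp
  then have "h\<^sub>1 x * (h\<^sub>1 x * g\<^sub>0 x) = h\<^sub>1 x * (g\<^sub>1 x * h\<^sub>0 x)"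
    by (simp add: geometric power2_eq_square mult_ac)
  then show ?thesis
    using nonzero[of x] by simp
qed

lemma ratio_constant:
  fixes h\<^sub>0 h\<^sub>1 :: "real \<Rightarrow> real"
  assumes "\<And>x. (h\<^sub>0 has_real_derivative g\<^sub>0 x) (at x)" "\<And>x. (h\<^sub>1 has_real_derivative g\<^sub>1 x) (at x)"
    and "\<And>x. h\<^sub>0 x \<noteq> 0" and "\<And>x. g\<^sub>1 x * h\<^sub>0 x = h\<^sub>1 x * g\<^sub>0 x"
  shows "h\<^sub>1 x / h\<^sub>0 x = h\<^sub>1 z / h\<^sub>0 z"
proof -
  have "((\<lambda>x. h\<^sub>1 x / h\<^sub>0 x) has_real_derivative 0) (at x)" for x
    using DERIV_divide[OF assms(2)[of x] assms(1)[of x] assms(3)[of x]] assms(4)[of x] by simp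
  then show ?thesis
    by (intro DERIV_isconst_all[where f = "\<lambda>x. h\<^sub>1 x / h\<^sub>0 x"]) blast
qed

text \<open>The growth rate in \<open>y\<close> is the logarithm of \<open>\<Theta>(t,x,1) / \<Theta>(t,x,0)\<close>. This ratio is constant in \<open>x\<close>
  because \<open>\<Theta>\<^sub>x / \<Theta>\<close> takes the same value at \<open>y = 0\<close> and \<open>y = 1\<close>, and constant in \<open>t\<close> because
  \<open>\<Theta>\<^sub>t / \<Theta> = B \<Theta>\<^sub>x / \<Theta>\<close> inherits this property.\<close>

lemma phase_growth_rate_constant:
  assumes smooth: "smooth3 \<Theta>" and pos: "\<And>t x y. \<Theta> t x y > 0"
    and heat: "\<And>t x y. heat_op \<Theta> t x y = 0"
    and airy: "\<And>t x y. airy_op \<Theta> t x y = 0"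
    and wave: "\<And>t x y. wave_y_op \<Theta> t x y = 0"
  obtains b where "\<And>t x y. \<Theta> t x y = \<Theta> t x 0 * exp (b * y)"
    "\<And>t x y. pd_x (pd_x \<Theta>) t x y = b * \<Theta> t x y"
    "\<And>t x y. pd_t \<Theta> t x y = b * pd_x \<Theta> t x y"
proof -
  note d = smooth3_has_pd[OF smooth] smooth3_has_pd[OF smooth3_pd(2)[OF smooth]]
  have heat': "pd_x (pd_x \<Theta>) t x y = pd_y \<Theta> t x y"
    and airy': "pd_t \<Theta> t x y = pd_x (pd_x (pd_x \<Theta>)) t x y"
    and wave': "pd_y (pd_y \<Theta>) t x y = (pd_y \<Theta> t x y)\<^sup>2 / \<Theta> t x y" for t x y
    using heat[of t x y] airy[of t x y] wave[of t x y]
    by (simp_all add: heat_op_def airy_op_def wave_y_op_def)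
  define B where "B t x = pd_y \<Theta> t x 0 / \<Theta> t x 0" for t x
  have dyy: "((\<lambda>\<eta>. pd_y \<Theta> t x \<eta>) has_real_derivative (pd_y \<Theta> t x y)\<^sup>2 / \<Theta> t x y) (at y)" for t x y
    using smooth3_has_pd(3)[OF smooth3_pd(3)[OF smooth], of t x y] by (simp add: wave')
  have xx: "pd_x (pd_x \<Theta>) t x y = B t x * \<Theta> t x y"
    and expo: "\<Theta> t x y = \<Theta> t x 0 * exp (B t x * y)" for t x y
    using log_derivative_constant[of "\<Theta> t x" "pd_y \<Theta> t x" y] d(3) dyy pos
    by (auto simp: heat' B_def)
  have nz: "\<Theta> t x y \<noteq> 0" for t x y
    using pos[of t x y] by simp
  have same: "pd_x \<Theta> t x 1 * \<Theta> t x 0 = \<Theta> t x 1 * pd_x \<Theta> t x 0" for t x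
  proof (rule geometric_solutions_same_log_derivative[where h\<^sub>0 = "\<lambda>x. \<Theta> t x 0"
        and h\<^sub>1 = "\<lambda>x. \<Theta> t x 1" and h\<^sub>2 = "\<lambda>x. \<Theta> t x 2" and g\<^sub>2 = "\<lambda>x. pd_x \<Theta> t x 2" and b = "B t"])
    show "((\<lambda>x. pd_x \<Theta> t x 0) has_real_derivative B t x * \<Theta> t x 0) (at x)"
      "((\<lambda>x. pd_x \<Theta> t x 1) has_real_derivative B t x * \<Theta> t x 1) (at x)"
      "((\<lambda>x. pd_x \<Theta> t x 2) has_real_derivative B t x * \<Theta> t x 2) (at x)" for x
      using d(5)[of t _ x] unfolding xx by auto
    show "\<Theta> t x 0 * \<Theta> t x 2 = (\<Theta> t x 1)\<^sup>2" for x
      using expo[of t x 1] expo[of t x 2] by (simp add: power2_eq_square flip: exp_add)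
  qed (use d(2) nz in auto)
  have B_ratio: "B t x = ln (\<Theta> t x 1 / \<Theta> t x 0)" for t x
    using expo[of t x 1] pos[of t x 0] by simp
  have B_x: "B t x = B t z" for t x z
    unfolding B_ratio
    by (rule arg_cong[of _ _ ln], rule ratio_constant[OF d(2) d(2) nz same])
  have t_x: "pd_t \<Theta> t x y = B t x * pd_x \<Theta> t x y" for t x y
  proof -
    have "(\<lambda>\<xi>. pd_x (pd_x \<Theta>) t \<xi> y) = (\<lambda>\<xi>. B t x * \<Theta> t \<xi> y)"
      by (rule ext) (metis xx B_x)
    then have "((\<lambda>\<xi>. pd_x (pd_x \<Theta>) t \<xi> y) has_real_derivative B t x * pd_x \<Theta> t x y) (at x)"
      using DERIV_cmult[OF d(2)] by simp
    then show ?thesis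
      unfolding airy' by (subst pd_x_def) (rule DERIV_imp_deriv)
  qed
  have same_t: "pd_t \<Theta> t x 1 * \<Theta> t x 0 = \<Theta> t x 1 * pd_t \<Theta> t x 0" for t x
    unfolding t_x using same[of t x] by algebra
  have B_t: "B t x = B r x" for t r x
    unfolding B_ratio
    by (rule arg_cong[of _ _ ln], rule ratio_constant[OF d(1) d(1) nz same_t])
  have B: "B t x = B 0 0" for t x
    using B_x[of t x 0] B_t[of t 0 0] by simp
  show ?thesis
    by (rule that[of "B 0 0"]; metis expo xx t_x B)
qed

text \<open>The function \<open>h(t,x) = \<Theta>(t,x,0)\<close> satisfies \<open>h\<^sub>x\<^sub>x = b h\<close> and \<open>h\<^sub>t = b h\<^sub>x\<close>. For \<open>b = k\<^sup>2 > 0\<close> the first equation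
  gives \<open>h = c\<^sub>1(t) exp(k x) + c\<^sub>2(t) exp(- k x)\<close>, and the second one \<open>c\<^sub>1' = k\<^sup>3 c\<^sub>1\<close> and \<open>c\<^sub>2' = - k\<^sup>3 c\<^sub>2\<close>.
  A constant phase appears as the degenerate case \<open>k = 0\<close>.\<close>

lemma positive_phase_is_exponential_sum:
  assumes smooth: "smooth3 \<Theta>" and pos: "\<And>t x y. \<Theta> t x y > 0"
    and "\<And>t x y. heat_op \<Theta> t x y = 0" "\<And>t x y. airy_op \<Theta> t x y = 0"
      "\<And>t x y. wave_y_op \<Theta> t x y = 0"
  obtains a\<^sub>1 a\<^sub>2 k where "a\<^sub>1 \<ge> 0" "a\<^sub>2 \<ge> 0" "\<Theta> = line_phase a\<^sub>1 a\<^sub>2 k (- k)"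
proof -
  obtain b where expo: "\<And>t x y. \<Theta> t x y = \<Theta> t x 0 * exp (b * y)"
    and xx: "\<And>t x y. pd_x (pd_x \<Theta>) t x y = b * \<Theta> t x y"
    and tx: "\<And>t x y. pd_t \<Theta> t x y = b * pd_x \<Theta> t x y"
    using phase_growth_rate_constant[OF assms] by blast
  define h g where "h t x = \<Theta> t x 0" and "g t x = pd_x \<Theta> t x 0" for t x
  have hx: "(h t has_real_derivative g t x) (at x)"
    and gx: "(g t has_real_derivative b * h t x) (at x)"
    and ht: "((\<lambda>t. h t x) has_real_derivative b * g t x) (at t)" for t x
    using smooth3_has_pd(2)[OF smooth, of t 0 x] smooth3_has_pd(1)[OF smooth, of x 0 t]
      smooth3_has_pd(2)[OF smooth3_pd(2)[OF smooth], of t 0 x]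
    by (simp_all add: h_def[abs_def] g_def[abs_def] xx tx)
  have h_pos: "h t x > 0" for t x
    by (simp add: h_def pos)
  have "b \<ge> 0"
    using positive_solution_rate_nonneg[OF hx gx h_pos] .
  show ?thesis
  proof (cases "b = 0")
    case True
    have "g t x = 0" for t x
      using positive_affine_slope_zero[OF hx _ h_pos] gx True by simp
    then have "h t x = h t 0" "h t 0 = h 0 0" for t x
      using DERIV_isconst_all[of "h t"] DERIV_isconst_all[of "\<lambda>t. h t 0"] hx ht by auto
    then have "\<Theta> t x y = h 0 0" for t x y
      using expo[of t x y] True unfolding h_def by (metis exp_zero mult_1_right mult_zero_left)
    then have "\<Theta> = line_phase (h 0 0) 0 0 (- 0)"
      by (simp add: line_phase_def fun_eq_iff)
    then show ?thesis
      using h_pos[of 0 0] by (intro that[of "h 0 0" 0 0]) simp_all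
  next
    case False
    define k where "k = sqrt b"
    have "k > 0" and b: "b = k\<^sup>2"
      using False \<open>b \<ge> 0\<close> by (simp_all add: k_def)
    define c\<^sub>1 c\<^sub>2 where "c\<^sub>1 t = (k * h t 0 + g t 0) / (2 * k)" and "c\<^sub>2 t = (k * h t 0 - g t 0) / (2 * k)"
      for t
    have h_eq: "h t x = c\<^sub>1 t * exp (k * x) + c\<^sub>2 t * exp (- k * x)"
      and g_eq: "g t x = k * (c\<^sub>1 t * exp (k * x) - c\<^sub>2 t * exp (- k * x))" for t x
      unfolding c\<^sub>1_def c\<^sub>2_def using \<open>k > 0\<close>
      by (intro hyperbolic_ODE[OF hx gx[unfolded b]]; simp)+
    have gt: "((\<lambda>t. g t 0) has_real_derivative pd_t (pd_x \<Theta>) t 0 0) (at t)" for t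
      using smooth3_has_pd(1)[OF smooth3_pd(2)[OF smooth]] by (simp add: g_def)
    define e\<^sub>1 e\<^sub>2 where "e\<^sub>1 t = (k * (b * g t 0) + pd_t (pd_x \<Theta>) t 0 0) / (2 * k)"
      and "e\<^sub>2 t = (k * (b * g t 0) - pd_t (pd_x \<Theta>) t 0 0) / (2 * k)" for t
    have dc: "(c\<^sub>1 has_real_derivative e\<^sub>1 t) (at t)" "(c\<^sub>2 has_real_derivative e\<^sub>2 t) (at t)" for t
      unfolding c\<^sub>1_def[abs_def] c\<^sub>2_def[abs_def] e\<^sub>1_def e\<^sub>2_def
      by (intro DERIV_cdivide DERIV_add DERIV_diff DERIV_cmult ht gt)+
    have "(e\<^sub>1 t - k ^ 3 * c\<^sub>1 t) * exp (k * x) + (e\<^sub>2 t + k ^ 3 * c\<^sub>2 t) * exp (- k * x) = 0" for t x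
    proof -
      have "((\<lambda>t. h t x) has_real_derivative e\<^sub>1 t * exp (k * x) + e\<^sub>2 t * exp (- k * x)) (at t)"
        unfolding h_eq by (intro DERIV_add DERIV_cmult_right dc)
      then have "e\<^sub>1 t * exp (k * x) + e\<^sub>2 t * exp (- k * x) = b * g t x"
        using ht DERIV_unique by blast
      then show ?thesis
        by (simp add: g_eq b power2_eq_square power3_eq_cube algebra_simps)
    qed
    note rates = exponentials_independent[OF this less_imp_neq[OF \<open>k > 0\<close>, symmetric]]
    have e: "e\<^sub>1 t = k ^ 3 * c\<^sub>1 t" "e\<^sub>2 t = - (k ^ 3) * c\<^sub>2 t" for t
      using rates[of t] by simp_all
    have c: "c\<^sub>1 t = c\<^sub>1 0 * exp (k ^ 3 * t)" "c\<^sub>2 t = c\<^sub>2 0 * exp (- (k ^ 3) * t)" for t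
      by (rule exponential_ODE, use dc in \<open>simp add: e\<close>)+
    have "\<Theta> t x y = line_phase (c\<^sub>1 0) (c\<^sub>2 0) k (- k) t x y" for t x y
    proof -
      have "\<Theta> t x y = (c\<^sub>1 0 * exp (k ^ 3 * t) * exp (k * x) + c\<^sub>2 0 * exp (- (k ^ 3) * t) * exp (- k * x))
          * exp (k\<^sup>2 * y)"
        using expo[of t x y] h_eq[of t x] unfolding h_def b c[of t] by metis
      moreover have "(- k)\<^sup>2 = k\<^sup>2" "(- k) ^ 3 = - (k ^ 3)"
        by simp_all
      ultimately show ?thesis
        by (simp only: line_phase_def exp_add ring_distribs mult_ac)
    qed
    then have "\<Theta> = line_phase (c\<^sub>1 0) (c\<^sub>2 0) k (- k)"
      by (intro ext)
    moreover have "c\<^sub>1 0 \<ge> 0" "c\<^sub>2 0 \<ge> 0"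
      using exponentials_positive_imp_coeffs_nonneg[OF h_pos[of 0, unfolded h_eq]] \<open>k > 0\<close> by simp_all
    ultimately show ?thesis
      using that by blast
  qed
qed

section \<open>The profile\<close>

lemma profile_deriv_ray:
  assumes "smooth_profile {0<..} F" "s > 0"
  shows "(profile_deriv {0<..} n F has_real_derivative profile_deriv {0<..} (Suc n) F s) (at s)"
proof -
  have "profile_deriv {0<..} n F differentiable at s"
    using assms unfolding smooth_profile_def differentiable_on_def
    by (metis at_within_open greaterThan_iff open_greaterThan)
  then show ?thesis
    using assms(2)
    by (simp add: profile_deriv_def vector_derivative_works has_real_derivative_iff_has_vector_derivative
        at_within_open[of s "{0<..}"])
qed

text \<open>All derivatives can be expressed by \<open>\<Theta>\<close> and \<open>D\<close>, the difference of its two terms, because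
  \<open>\<Theta>\<^sub>x = k D\<close>, \<open>D\<^sub>x = k \<Theta>\<close>, \<open>\<Theta>\<^sub>t = k\<^sup>3 D\<close>, \<open>D\<^sub>t = k\<^sup>3 \<Theta>\<close> and \<open>\<Theta>\<^sub>y = k\<^sup>2 \<Theta>\<close>. The function \<open>F n\<close> stands for
  the \<open>n\<close>-th derivative of the profile \<open>F 0\<close>.\<close>

lemma pd_profile_of_line_phase:
  fixes F :: "nat \<Rightarrow> real \<Rightarrow> real" and a\<^sub>1 a\<^sub>2 k :: real
  defines "\<Theta> \<equiv> line_phase a\<^sub>1 a\<^sub>2 k (- k)" and "D \<equiv> line_phase a\<^sub>1 (- a\<^sub>2) k (- k)"
  defines "f \<equiv> \<lambda>t x y. F 0 (\<Theta> t x y)"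
  assumes F: "\<And>n s. s > 0 \<Longrightarrow> (F n has_real_derivative F (Suc n) s) (at s)"
    and pos: "\<And>t x y. \<Theta> t x y > 0"
  shows "pd_x (pd_x f) t x y = k\<^sup>2 * (F 2 (\<Theta> t x y) * (D t x y)\<^sup>2 + F 1 (\<Theta> t x y) * \<Theta> t x y)"
    and "- 4 * pd_t (pd_x f) t x y + pd_x (pd_x (pd_x (pd_x f))) t x y
       + 6 * (pd_x (pd_x f) t x y)\<^sup>2 + 3 * pd_y (pd_y f) t x y
     = k ^ 4 * (F 4 (\<Theta> t x y) * D t x y ^ 4 + 6 * F 3 (\<Theta> t x y) * \<Theta> t x y * (D t x y)\<^sup>2
         + 6 * F 2 (\<Theta> t x y) * (\<Theta> t x y)\<^sup>2
         + 6 * (F 2 (\<Theta> t x y) * (D t x y)\<^sup>2 + F 1 (\<Theta> t x y) * \<Theta> t x y)\<^sup>2)"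
proof -
  have d\<Theta>: "((\<lambda>\<tau>. \<Theta> \<tau> x y) has_real_derivative k ^ 3 * D t x y) (at t)"
    "((\<lambda>\<xi>. \<Theta> t \<xi> y) has_real_derivative k * D t x y) (at x)"
    "((\<lambda>\<eta>. \<Theta> t x \<eta>) has_real_derivative k\<^sup>2 * \<Theta> t x y) (at y)" for t x y
    using line_phase_has_derivative[of a\<^sub>1 a\<^sub>2 k "- k"]
    by (simp_all add: \<Theta>_def D_def flip: line_phase_cmult)
  have dD: "((\<lambda>\<tau>. D \<tau> x y) has_real_derivative k ^ 3 * \<Theta> t x y) (at t)"
    "((\<lambda>\<xi>. D t \<xi> y) has_real_derivative k * \<Theta> t x y) (at x)" for t x y
    using line_phase_has_derivative[of a\<^sub>1 "- a\<^sub>2" k "- k"]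
    by (simp_all add: \<Theta>_def D_def flip: line_phase_cmult)
  have dF: "((\<lambda>\<tau>. F n (\<Theta> \<tau> x y)) has_real_derivative F (Suc n) (\<Theta> t x y) * (k ^ 3 * D t x y)) (at t)"
    "((\<lambda>\<xi>. F n (\<Theta> t \<xi> y)) has_real_derivative F (Suc n) (\<Theta> t x y) * (k * D t x y)) (at x)"
    "((\<lambda>\<eta>. F n (\<Theta> t x \<eta>)) has_real_derivative F (Suc n) (\<Theta> t x y) * (k\<^sup>2 * \<Theta> t x y)) (at y)"
    for n t x y
    by (rule DERIV_chain2[OF F[OF pos] d\<Theta>(1)] DERIV_chain2[OF F[OF pos] d\<Theta>(2)]
        DERIV_chain2[OF F[OF pos] d\<Theta>(3)])+
  note numerals = eval_nat_numeral
  have x1: "pd_x f = (\<lambda>t x y. k * F 1 (\<Theta> t x y) * D t x y)"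
    unfolding f_def
    by (rule pd_eqI, rule DERIV_cong[OF dF(2)]) simp
  have x2: "pd_x (pd_x f) = (\<lambda>t x y. k\<^sup>2 * (F 2 (\<Theta> t x y) * (D t x y)\<^sup>2 + F 1 (\<Theta> t x y) * \<Theta> t x y))"
    unfolding x1 by (rule pd_eqI)
      (rule derivative_eq_intros dF dD d\<Theta> refl | simp add: numerals algebra_simps)+
  have x3: "pd_x (pd_x (pd_x f)) = (\<lambda>t x y. k ^ 3 * (F 3 (\<Theta> t x y) * D t x y ^ 3
      + 3 * F 2 (\<Theta> t x y) * \<Theta> t x y * D t x y + F 1 (\<Theta> t x y) * D t x y))"
    unfolding x2 by (rule pd_eqI)
      (rule derivative_eq_intros dF dD d\<Theta> refl | simp add: numerals algebra_simps)+
  have x4: "pd_x (pd_x (pd_x (pd_x f))) = (\<lambda>t x y. k ^ 4 * (F 4 (\<Theta> t x y) * D t x y ^ 4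
      + 6 * F 3 (\<Theta> t x y) * \<Theta> t x y * (D t x y)\<^sup>2
      + F 2 (\<Theta> t x y) * (4 * (D t x y)\<^sup>2 + 3 * (\<Theta> t x y)\<^sup>2) + F 1 (\<Theta> t x y) * \<Theta> t x y))"
    unfolding x3 by (rule pd_eqI)
      (rule derivative_eq_intros dF dD d\<Theta> refl | simp add: numerals algebra_simps)+
  have tx: "pd_t (pd_x f) = (\<lambda>t x y. k ^ 4 * (F 2 (\<Theta> t x y) * (D t x y)\<^sup>2 + F 1 (\<Theta> t x y) * \<Theta> t x y))"
    unfolding x1 by (rule pd_eqI)
      (rule derivative_eq_intros dF dD d\<Theta> refl | simp add: numerals algebra_simps)+
  have y1: "pd_y f = (\<lambda>t x y. k\<^sup>2 * F 1 (\<Theta> t x y) * \<Theta> t x y)"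
    unfolding f_def
    by (rule pd_eqI, rule DERIV_cong[OF dF(3)]) simp
  have y2: "pd_y (pd_y f) = (\<lambda>t x y. k ^ 4 * (F 2 (\<Theta> t x y) * (\<Theta> t x y)\<^sup>2 + F 1 (\<Theta> t x y) * \<Theta> t x y))"
    unfolding y1 by (rule pd_eqI)
      (rule derivative_eq_intros dF dD d\<Theta> refl | simp add: numerals algebra_simps)+
  show "pd_x (pd_x f) t x y = k\<^sup>2 * (F 2 (\<Theta> t x y) * (D t x y)\<^sup>2 + F 1 (\<Theta> t x y) * \<Theta> t x y)"
    by (simp add: x2)
  show "- 4 * pd_t (pd_x f) t x y + pd_x (pd_x (pd_x (pd_x f))) t x y
       + 6 * (pd_x (pd_x f) t x y)\<^sup>2 + 3 * pd_y (pd_y f) t x y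
     = k ^ 4 * (F 4 (\<Theta> t x y) * D t x y ^ 4 + 6 * F 3 (\<Theta> t x y) * \<Theta> t x y * (D t x y)\<^sup>2
         + 6 * F 2 (\<Theta> t x y) * (\<Theta> t x y)\<^sup>2
         + 6 * (F 2 (\<Theta> t x y) * (D t x y)\<^sup>2 + F 1 (\<Theta> t x y) * \<Theta> t x y)\<^sup>2)"
    by (subst x4, subst tx, subst y2, subst x2)
      (simp add: power_mult_distrib flip: power_mult, simp add: algebra_simps)
qed

text \<open>The equation says \<open>(exp F)'' = 0\<close>, so \<open>exp F\<close> is affine, and its value and slope at \<open>1\<close> are those of
  the identity. The substitution \<open>s = exp z\<close> turns the half-line into the whole line, where
  functions with zero derivative are constant.\<close>

lemma log_from_Riccati:
  fixes F F\<^sub>1 F\<^sub>2 :: "real \<Rightarrow> real"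
  assumes F: "\<And>s. s > 0 \<Longrightarrow> (F has_real_derivative F\<^sub>1 s) (at s)"
    and F\<^sub>1: "\<And>s. s > 0 \<Longrightarrow> (F\<^sub>1 has_real_derivative F\<^sub>2 s) (at s)"
    and Riccati: "\<And>s. s > 0 \<Longrightarrow> F\<^sub>2 s + (F\<^sub>1 s)\<^sup>2 = 0"
    and init: "F 1 = 0" "F\<^sub>1 1 = 1" and "s > 0"
  shows "F s = ln s"
proof -
  have dF: "((\<lambda>z. F (exp z)) has_real_derivative F\<^sub>1 (exp z) * exp z) (at z)"
    and dF\<^sub>1: "((\<lambda>z. F\<^sub>1 (exp z)) has_real_derivative F\<^sub>2 (exp z) * exp z) (at z)" for z
    by (rule DERIV_chain2[OF F DERIV_exp] DERIV_chain2[OF F\<^sub>1 DERIV_exp]; simp)+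
  have F\<^sub>2: "F\<^sub>2 (exp z) = - (F\<^sub>1 (exp z))\<^sup>2" for z
    using Riccati[of "exp z"] by simp
  have "((\<lambda>z. F\<^sub>1 (exp z) * exp (F (exp z))) has_real_derivative 0) (at z)" for z
    by (rule derivative_eq_intros dF dF\<^sub>1 refl | simp add: F\<^sub>2 power2_eq_square algebra_simps)+
  then have slope: "F\<^sub>1 (exp z) * exp (F (exp z)) = F\<^sub>1 (exp 0) * exp (F (exp 0))" for z
    by (intro DERIV_isconst_all[where f = "\<lambda>z. F\<^sub>1 (exp z) * exp (F (exp z))"]) blast
  have "((\<lambda>z. exp (F (exp z)) - exp z) has_real_derivative 0) (at z)" for z
    using slope[of z]
    by (auto intro!: derivative_eq_intros dF simp: init algebra_simps)
  then have "exp (F (exp (ln s))) - exp (ln s) = exp (F (exp 0)) - exp 0"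
    by (intro DERIV_isconst_all[where f = "\<lambda>z. exp (F (exp z)) - exp z"]) blast
  then have "exp (F s) = s"
    using \<open>s > 0\<close> by (simp add: init)
  then show ?thesis
    by (metis ln_exp)
qed

text \<open>In the variable \<open>z = ln s\<close> the expression \<open>F'' s\<^sup>2 + F' s\<close> is the second derivative \<open>w\<close> of
  \<open>F(exp z)\<close>, and the hypothesis becomes the travelling wave equation \<open>w'' = w - 6 w\<^sup>2\<close>. The
  initial values are those of the logarithm, for which \<open>w = w' = 0\<close>.\<close>

lemma travelling_wave_profile_trivial:
  fixes F :: "nat \<Rightarrow> real \<Rightarrow> real"
  assumes F: "\<And>n s. s > 0 \<Longrightarrow> (F n has_real_derivative F (Suc n) s) (at s)"
    and ODE: "\<And>s. s > 0 \<Longrightarrow> F 4 s * s ^ 4 + 6 * F 3 s * s * s\<^sup>2 + 6 * F 2 s * s\<^sup>2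
      + 6 * (F 2 s * s\<^sup>2 + F 1 s * s)\<^sup>2 = 0"
    and init: "F 1 1 = 1" "F 2 1 = - 1" "F 3 1 = 2" and "s > 0"
  shows "F 2 s * s\<^sup>2 + F 1 s * s = 0"
proof -
  define w where "w z = F 2 (exp z) * (exp z)\<^sup>2 + F 1 (exp z) * exp z" for z
  define v where "v z = F 3 (exp z) * exp z ^ 3 + 3 * F 2 (exp z) * (exp z)\<^sup>2 + F 1 (exp z) * exp z" for z
  have dF: "((\<lambda>z. F n (exp z)) has_real_derivative F (Suc n) (exp z) * exp z) (at z)" for n z
    by (rule DERIV_chain2[OF F DERIV_exp]) simp
  have dw: "(w has_real_derivative v z) (at z)" for z
    unfolding w_def[abs_def] v_def
    by (rule derivative_eq_intros dF refl | simp add: eval_nat_numeral algebra_simps)+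
  have "(v has_real_derivative F 4 (exp z) * exp z ^ 4 + 6 * F 3 (exp z) * exp z ^ 3
      + 7 * F 2 (exp z) * (exp z)\<^sup>2 + F 1 (exp z) * exp z) (at z)" for z
    unfolding v_def[abs_def]
    by (rule derivative_eq_intros dF refl | simp add: eval_nat_numeral algebra_simps)+
  moreover have "F 4 (exp z) * exp z ^ 4 + 6 * F 3 (exp z) * exp z ^ 3
      + 7 * F 2 (exp z) * (exp z)\<^sup>2 + F 1 (exp z) * exp z = (1 - 6 * w z) * w z" for z
    using ODE[of "exp z"] by (simp add: w_def eval_nat_numeral algebra_simps)
  ultimately have dv: "(v has_real_derivative (1 - 6 * w z) * w z) (at z)" for z
    by metis
  have "continuous_on UNIV w"
    using dw by (auto intro!: DERIV_isCont continuous_at_imp_continuous_on)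
  then have "continuous_on UNIV (\<lambda>z. 1 - 6 * w z)"
    by (intro continuous_intros)
  moreover have "w 0 = 0" "v 0 = 0"
    unfolding w_def v_def using init by simp_all
  ultimately have "w (ln s) = 0"
    by (rule second_order_linear_uniqueness[OF dw dv])
  then show ?thesis
    using \<open>s > 0\<close> by (simp add: w_def)
qed

section \<open>The characterisation\<close>

theorem theorem1p4:
  fixes S :: "real set" and F :: "real \<Rightarrow> real"
    and \<Theta> u :: "real \<Rightarrow> real \<Rightarrow> real \<Rightarrow> real"
  assumes domain: "profile_domain S"
    and F_smooth: "smooth_profile S F"
    and \<Theta>_smooth: "smooth3 \<Theta>"
    and \<Theta>_range: "\<And>t x y. \<Theta> t x y \<in> S"
    and u_form: "u = (\<lambda>t x y. 2 * pd_x (pd_x (\<lambda>t x y. F (\<Theta> t x y))) t x y)"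
    and u_smooth: "smooth3 u"
    and u_KP: "KP_II u"
    and u_KP_integrated: "KP_II_integrated (\<lambda>t x y. F (\<Theta> t x y))"
    and u_nontrivial: "\<exists>t x y. u t x y \<noteq> 0"
    and F_at_1: "F 1 = 0" "profile_deriv S 1 F 1 = 1"
      "profile_deriv S 2 F 1 = - 1" "profile_deriv S 3 F 1 = 2"
  shows "((\<forall>s\<in>S. F s = ln s) \<and> KdV_soliton_phase \<Theta>) \<longleftrightarrow>
    (\<forall>t x y. heat_op \<Theta> t x y = 0 \<and> airy_op \<Theta> t x y = 0 \<and> wave_y_op \<Theta> t x y = 0)"
proof
  assume "(\<forall>s\<in>S. F s = ln s) \<and> KdV_soliton_phase \<Theta>"
  then show "\<forall>t x y. heat_op \<Theta> t x y = 0 \<and> airy_op \<Theta> t x y = 0 \<and> wave_y_op \<Theta> t x y = 0"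
    using KdV_soliton_phase_equations by blast
next
  assume phase_eqs:
    "\<forall>t x y. heat_op \<Theta> t x y = 0 \<and> airy_op \<Theta> t x y = 0 \<and> wave_y_op \<Theta> t x y = 0"
  have pos: "\<Theta> t x y > 0" for t x y
    using domain \<Theta>_range[of t x y] unfolding profile_domain_def by force
  obtain a\<^sub>1 a\<^sub>2 k where a: "a\<^sub>1 \<ge> 0" "a\<^sub>2 \<ge> 0" and \<Theta>: "\<Theta> = line_phase a\<^sub>1 a\<^sub>2 k (- k)"
    using positive_phase_is_exponential_sum[OF \<Theta>_smooth pos] phase_eqs by metis
  have "k \<noteq> 0"
  proof
    assume "k = 0"
    then have "u = (\<lambda>t x y. 0)"
      unfolding u_form \<Theta> pd_x_def by (simp add: line_phase_def)
    then show False
      using u_nontrivial by simp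
  qed
  have a_sum: "a\<^sub>1 + a\<^sub>2 > 0"
    using pos[of 0 0 0] by (simp add: \<Theta> line_phase_def)
  \<comment> \<open>The phase takes every positive value, which rules out a domain bounded away from \<open>0\<close>.\<close>
  have level: "\<exists>y. \<Theta> 0 0 y = s" if "s > 0" for s
  proof
    have "exp (k\<^sup>2 * (ln (s / (a\<^sub>1 + a\<^sub>2)) / k\<^sup>2)) = s / (a\<^sub>1 + a\<^sub>2)"
      using that a_sum \<open>k \<noteq> 0\<close> by simp
    then show "\<Theta> 0 0 (ln (s / (a\<^sub>1 + a\<^sub>2)) / k\<^sup>2) = s"
      using a_sum by (simp add: \<Theta> line_phase_def flip: distrib_right)
  qed
  then have onto: "s \<in> S" if "s > 0" for s
    using \<Theta>_range that by metis
  have S: "S = {0<..}"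
    using domain onto unfolding profile_domain_def
    by (metis atLeast_iff dense linorder_not_less)
  define G where "G n = profile_deriv S n F" for n
  have G0: "G 0 = F"
    by (simp add: G_def profile_deriv_def)
  have dG: "(G n has_real_derivative G (Suc n) s) (at s)" if "s > 0" for n s
    using profile_deriv_ray[of F s n] F_smooth that by (simp add: G_def S)
  have init: "G 0 1 = 0" "G 1 1 = 1" "G 2 1 = - 1" "G 3 1 = 2"
    using F_at_1 by (simp_all add: G0) (simp_all add: G_def)
  define D where "D = line_phase a\<^sub>1 (- a\<^sub>2) k (- k)"
  note pds = pd_profile_of_line_phase[where F = G, OF dG pos[unfolded \<Theta>], folded D_def \<Theta>, unfolded G0]
  have uxx: "u t x y = 2 * (k\<^sup>2 * (G 2 (\<Theta> t x y) * (D t x y)\<^sup>2 + G 1 (\<Theta> t x y) * \<Theta> t x y))" for t x y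
    unfolding u_form by (simp add: pds(1))
  have KP: "G 4 (\<Theta> t x y) * D t x y ^ 4 + 6 * G 3 (\<Theta> t x y) * \<Theta> t x y * (D t x y)\<^sup>2
         + 6 * G 2 (\<Theta> t x y) * (\<Theta> t x y)\<^sup>2
         + 6 * (G 2 (\<Theta> t x y) * (D t x y)\<^sup>2 + G 1 (\<Theta> t x y) * \<Theta> t x y)\<^sup>2 = 0" for t x y
    using trans[OF sym[OF pds(2)] u_KP_integrated[unfolded KP_II_integrated_def, rule_format]]
      \<open>k \<noteq> 0\<close> by simp
  have both: "a\<^sub>1 > 0 \<and> a\<^sub>2 > 0"
  proof (rule ccontr)
    assume "\<not> (a\<^sub>1 > 0 \<and> a\<^sub>2 > 0)"
    then have D_sq: "(D t x y)\<^sup>2 = (\<Theta> t x y)\<^sup>2" for t x y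
      using a by (auto simp: D_def \<Theta> line_phase_def)
    then have D_4: "D t x y ^ 4 = \<Theta> t x y ^ 4" for t x y
      by (metis numeral_Bit0 power_add power2_eq_square power4_eq_xxxx mult.assoc)
    have "G 4 s * s ^ 4 + 6 * G 3 s * s * s\<^sup>2 + 6 * G 2 s * s\<^sup>2
      + 6 * (G 2 s * s\<^sup>2 + G 1 s * s)\<^sup>2 = 0" if "s > 0" for s
    proof -
      obtain y where "\<Theta> 0 0 y = s"
        using \<open>s > 0\<close> level by blast
      then show ?thesis
        using KP[of 0 0 y] by (simp add: D_sq D_4)
    qed
    then have "u t x y = 0" for t x y
      using travelling_wave_profile_trivial[of G "\<Theta> t x y", OF dG _ init(2-4) pos]
      by (simp add: uxx D_sq)
    then show False
      using u_nontrivial by simp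
  qed
  have "G 2 s + (G 1 s)\<^sup>2 = 0" if "s > 0" for s
  proof -
    \<comment> \<open>The choice of \<open>x\<close> balances the two terms, so that \<open>D = 0\<close>; then \<open>y\<close> makes each equal to \<open>s / 2\<close>.\<close>
    define x where "x = ln (a\<^sub>2 / a\<^sub>1) / (2 * k)"
    define y where "y = ln (s / (2 * a\<^sub>1 * exp (k * x))) / k\<^sup>2"
    have ey: "exp (k\<^sup>2 * y) = s / (2 * a\<^sub>1 * exp (k * x))"
      using that both \<open>k \<noteq> 0\<close> by (simp add: y_def)
    have ex: "a\<^sub>1 * exp (k * x) = a\<^sub>2 * exp (- (k * x))"
    proof -
      have "exp (k * x) * exp (k * x) = a\<^sub>2 / a\<^sub>1"
        using both \<open>k \<noteq> 0\<close> by (simp add: x_def flip: exp_add)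
      then show ?thesis
        using both by (simp add: exp_minus field_simps)
    qed
    have "a\<^sub>1 * exp (k * x + k\<^sup>2 * y) = s / 2"
      using both by (simp add: exp_add ey)
    moreover have "a\<^sub>2 * exp (- (k * x) + k\<^sup>2 * y) = a\<^sub>1 * exp (k * x + k\<^sup>2 * y)"
      unfolding exp_add mult.assoc[symmetric] ex ..
    ultimately have "\<Theta> 0 x y = s" "D 0 x y = 0"
      by (simp_all add: \<Theta> D_def line_phase_def)
    then have "6 * s\<^sup>2 * (G 2 s + (G 1 s)\<^sup>2) = 0"
      using KP[of 0 x y] by (simp add: power2_eq_square algebra_simps)
    then show ?thesis
      using that by simp
  qed
  then have "\<forall>s\<in>S. F s = ln s"
    using log_from_Riccati[of "G 0" "G 1" "G 2"] dG[where n = 0] dG[where n = 1] init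
    by (simp add: S G0 numeral_2_eq_2)
  then show "(\<forall>s\<in>S. F s = ln s) \<and> KdV_soliton_phase \<Theta>"
    using \<Theta> both unfolding KdV_soliton_phase_def by blast
qed

end
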